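(* There are finitary existential formulas in the language of groups, with no parameters, which, uniformly for every field $F$, define an effective interpretation of $F$ in its Heisenberg group $H(F)$, in which the elements of $F$ are represented by triples of elements of $H(F)$. That is, there are finitary existential formulas $\delta(\bar x)$, $\sigma(\bar x,\bar y)$, $\sigma'(\bar x,\bar y)$, $\rho_+(\bar x,\bar y,\bar z)$, $\rho_+'(\bar x,\bar y,\bar z)$, $\rho_\cdot(\bar x,\bar y,\bar z)$, $\rho_\cdot'(\bar x,\bar y,\bar z)$ (each of $\bar x,\bar y,\bar z$ a triple of variables) such that for every field $F$, letting $D\subseteq H(F)^3$ be the set defined by $\delta$, $\sim$ the relation on $D$ defined by $\sigma$, and $\oplus,\odot$ the ternary relations on $D$ defined by $\rho_+,\rho_\cdot$: $\sim$ is an equivalence relation on $D$ respecting $\oplus$ and $\odot$, the quotient $(D,\oplus,\odot)/\!\sim$ is isomorphic to $F$ viewed as the relational structure $(F,\mathrm{graph}(+),\mathrm{graph}(\cdot))$, and $\sigma'$, $\rho'_+$, $\rho'_\cdot$ define within $D^2$, resp. $D^3$, the complements of $\sim$, $\oplus$, $\odot$.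
   Context: For a field $F$, the Heisenberg group $H(F)$ is the group, under matrix multiplication, of all matrices $h(a,b,c)=\begin{pmatrix}1&a&c\\0&1&b\\0&0&1\end{pmatrix}$ with $a,b,c\in F$. A formula is finitary existential if it is a first-order formula of the form $\exists \bar w\,\theta$ with $\theta$ quantifier-free. *)

theory Defs
  imports "HOL-Algebra.Ring" "HOL-Analysis.Finite_Cartesian_Product"
begin

section \<open>First-order formulas in the language of groups\<close>

datatype gterm =
    Var nat
  | One
  | Inv gterm
  | Mult gterm gterm

datatype fm =
    Eq gterm gterm
  | Neg fm
  | Conj fm fm
  | Disj fm fm
  | Ex nat fm
  | All nat fm

primrec fv_term :: "gterm \<Rightarrow> nat set" where
  "fv_term (Var i) = {i}"
| "fv_term One = {}"
| "fv_term (Inv t) = fv_term t"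
| "fv_term (Mult s t) = fv_term s \<union> fv_term t"

primrec fv :: "fm \<Rightarrow> nat set" where
  "fv (Eq s t) = fv_term s \<union> fv_term t"
| "fv (Neg \<phi>) = fv \<phi>"
| "fv (Conj \<phi> \<psi>) = fv \<phi> \<union> fv \<psi>"
| "fv (Disj \<phi> \<psi>) = fv \<phi> \<union> fv \<psi>"
| "fv (Ex i \<phi>) = fv \<phi> - {i}"
| "fv (All i \<phi>) = fv \<phi> - {i}"

primrec quantifier_free :: "fm \<Rightarrow> bool" where
  "quantifier_free (Eq s t) \<longleftrightarrow> True"
| "quantifier_free (Neg \<phi>) \<longleftrightarrow> quantifier_free \<phi>"
| "quantifier_free (Conj \<phi> \<psi>) \<longleftrightarrow> quantifier_free \<phi> \<and> quantifier_free \<psi>"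
| "quantifier_free (Disj \<phi> \<psi>) \<longleftrightarrow> quantifier_free \<phi> \<and> quantifier_free \<psi>"
| "quantifier_free (Ex i \<phi>) \<longleftrightarrow> False"
| "quantifier_free (All i \<phi>) \<longleftrightarrow> False"

definition Exs :: "nat list \<Rightarrow> fm \<Rightarrow> fm" where
  "Exs ws \<theta> = foldr Ex ws \<theta>"

definition existential :: "fm \<Rightarrow> bool" where
  "existential \<phi> \<longleftrightarrow> (\<exists>ws \<theta>. quantifier_free \<theta> \<and> \<phi> = Exs ws \<theta>)"

primrec term_val :: "('g, 'm) monoid_scheme \<Rightarrow> (nat \<Rightarrow> 'g) \<Rightarrow> gterm \<Rightarrow> 'g" where
  "term_val G e (Var i) = e i"
| "term_val G e One = \<one>\<^bsub>G\<^esub>"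
| "term_val G e (Inv t) = inv\<^bsub>G\<^esub> (term_val G e t)"
| "term_val G e (Mult s t) = term_val G e s \<otimes>\<^bsub>G\<^esub> term_val G e t"

primrec sat :: "('g, 'm) monoid_scheme \<Rightarrow> (nat \<Rightarrow> 'g) \<Rightarrow> fm \<Rightarrow> bool" where
  "sat G e (Eq s t) \<longleftrightarrow> term_val G e s = term_val G e t"
| "sat G e (Neg \<phi>) \<longleftrightarrow> \<not> sat G e \<phi>"
| "sat G e (Conj \<phi> \<psi>) \<longleftrightarrow> sat G e \<phi> \<and> sat G e \<psi>"
| "sat G e (Disj \<phi> \<psi>) \<longleftrightarrow> sat G e \<phi> \<or> sat G e \<psi>"
| "sat G e (Ex i \<phi>) \<longleftrightarrow> (\<exists>x\<in>carrier G. sat G (e(i := x)) \<phi>)"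
| "sat G e (All i \<phi>) \<longleftrightarrow> (\<forall>x\<in>carrier G. sat G (e(i := x)) \<phi>)"

text \<open>Tuples are lists; \<^term>\<open>holds G \<phi> xs\<close> interprets the variable \<open>i\<close> by the \<open>i\<close>-th entry.
  The values of the remaining variables are irrelevant, since this is only used for formulas with
  \<^term>\<open>fv \<phi> \<subseteq> {..<length xs}\<close>.\<close>

definition holds :: "('g, 'm) monoid_scheme \<Rightarrow> fm \<Rightarrow> 'g list \<Rightarrow> bool" where
  "holds G \<phi> xs \<longleftrightarrow> sat G (\<lambda>i. if i < length xs then xs ! i else \<one>\<^bsub>G\<^esub>) \<phi>"

definition defset :: "('g, 'm) monoid_scheme \<Rightarrow> nat \<Rightarrow> fm \<Rightarrow> 'g list set" where
  "defset G n \<phi> = {x. length x = n \<and> set x \<subseteq> carrier G \<and> holds G \<phi> x}"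

definition defrel2 :: "('g, 'm) monoid_scheme \<Rightarrow> 'g list set \<Rightarrow> fm \<Rightarrow> ('g list \<times> 'g list) set" where
  "defrel2 G D \<phi> = {(x, y). x \<in> D \<and> y \<in> D \<and> holds G \<phi> (x @ y)}"

definition defrel3 ::
    "('g, 'm) monoid_scheme \<Rightarrow> 'g list set \<Rightarrow> fm \<Rightarrow> ('g list \<times> 'g list \<times> 'g list) set" where
  "defrel3 G D \<phi> = {(x, y, z). x \<in> D \<and> y \<in> D \<and> z \<in> D \<and> holds G \<phi> (x @ y @ z)}"


section \<open>Effective interpretations of a field in a group\<close>

definition respects3 :: "('b \<times> 'b) set \<Rightarrow> ('b \<times> 'b \<times> 'b) set \<Rightarrow> bool" where
  "respects3 E R \<longleftrightarrow>
     (\<forall>x x' y y' z z'. (x, x') \<in> E \<longrightarrow> (y, y') \<in> E \<longrightarrow> (z, z') \<in> E \<longrightarrow>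
        (x, y, z) \<in> R \<longrightarrow> (x', y', z') \<in> R)"

definition quot_rel3 :: "('b \<times> 'b) set \<Rightarrow> ('b \<times> 'b \<times> 'b) set \<Rightarrow> ('b set \<times> 'b set \<times> 'b set) set" where
  "quot_rel3 E R = {(E `` {x}, E `` {y}, E `` {z}) | x y z. (x, y, z) \<in> R}"

definition structure_iso ::
    "'b set \<Rightarrow> ('b \<times> 'b \<times> 'b) set \<Rightarrow> ('b \<times> 'b \<times> 'b) set \<Rightarrow>
     'a set \<Rightarrow> ('a \<times> 'a \<times> 'a) set \<Rightarrow> ('a \<times> 'a \<times> 'a) set \<Rightarrow> ('b \<Rightarrow> 'a) \<Rightarrow> bool" where
  "structure_iso A P T B P' T' f \<longleftrightarrow>
     bij_betw f A B \<and>
     (\<forall>x\<in>A. \<forall>y\<in>A. \<forall>z\<in>A.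
        ((x, y, z) \<in> P \<longleftrightarrow> (f x, f y, f z) \<in> P') \<and>
        ((x, y, z) \<in> T \<longleftrightarrow> (f x, f y, f z) \<in> T'))"

definition graph_add :: "('a, 'm) ring_scheme \<Rightarrow> ('a \<times> 'a \<times> 'a) set" where
  "graph_add F = {(a, b, a \<oplus>\<^bsub>F\<^esub> b) | a b. a \<in> carrier F \<and> b \<in> carrier F}"

definition graph_mult :: "('a, 'm) ring_scheme \<Rightarrow> ('a \<times> 'a \<times> 'a) set" where
  "graph_mult F = {(a, b, a \<otimes>\<^bsub>F\<^esub> b) | a b. a \<in> carrier F \<and> b \<in> carrier F}"

definition interprets ::
    "nat \<Rightarrow> ('g, 'n) monoid_scheme \<Rightarrow> ('a, 'm) ring_scheme \<Rightarrow>
     fm \<Rightarrow> fm \<Rightarrow> fm \<Rightarrow> fm \<Rightarrow> fm \<Rightarrow> fm \<Rightarrow> fm \<Rightarrow> bool" where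
  "interprets n G F \<delta> \<sigma> \<sigma>' \<rho>add \<rho>add' \<rho>mul \<rho>mul' \<longleftrightarrow>
     (let D = defset G n \<delta>;
          E = defrel2 G D \<sigma>;
          P = defrel3 G D \<rho>add;
          T = defrel3 G D \<rho>mul
      in equiv D E \<and> respects3 E P \<and> respects3 E T \<and>
         (\<exists>f. structure_iso (D // E) (quot_rel3 E P) (quot_rel3 E T)
                (carrier F) (graph_add F) (graph_mult F) f) \<and>
         defrel2 G D \<sigma>' = D \<times> D - E \<and>
         defrel3 G D \<rho>add' = D \<times> D \<times> D - P \<and>
         defrel3 G D \<rho>mul' = D \<times> D \<times> D - T)"


section \<open>The Heisenberg group\<close>

text \<open>Fields are records with a carrier, so that no field is excluded; the matrix product of
  HOL-Analysis, which needs a type class, is therefore repeated over the record. The index type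
  \<^typ>\<open>3\<close> has the elements 1, 2 and 3 (= 0).\<close>

definition mat_mult3 :: "('a, 'm) ring_scheme \<Rightarrow> 'a ^ 3 ^ 3 \<Rightarrow> 'a ^ 3 ^ 3 \<Rightarrow> 'a ^ 3 ^ 3" where
  "mat_mult3 F A B = (\<chi> i j. \<Oplus>\<^bsub>F\<^esub>k\<in>UNIV. A $ i $ k \<otimes>\<^bsub>F\<^esub> B $ k $ j)"

definition heis_mat :: "('a, 'm) ring_scheme \<Rightarrow> 'a \<Rightarrow> 'a \<Rightarrow> 'a \<Rightarrow> 'a ^ 3 ^ 3" where
  "heis_mat F a b c =
     (\<chi> i j. if i = j then \<one>\<^bsub>F\<^esub>
             else if i = 1 \<and> j = 2 then a
             else if i = 2 \<and> j = 3 then b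
             else if i = 1 \<and> j = 3 then c
             else \<zero>\<^bsub>F\<^esub>)"

definition heisenberg :: "('a, 'm) ring_scheme \<Rightarrow> ('a ^ 3 ^ 3) monoid" where
  "heisenberg F =
     \<lparr>carrier = {heis_mat F a b c | a b c. a \<in> carrier F \<and> b \<in> carrier F \<and> c \<in> carrier F},
      monoid.mult = mat_mult3 F,
      one = heis_mat F \<zero>\<^bsub>F\<^esub> \<zero>\<^bsub>F\<^esub> \<zero>\<^bsub>F\<^esub>\<rparr>"


section \<open>The interpreting formulas\<close>

text \<open>One fixed choice of formulas has to serve all fields. A formula \<open>\<exists>\<phi>. \<forall>F. \<dots>\<close> with
  \<open>F\<close> of type \<^typ>\<open>('a, 'm) ring_scheme\<close> would only give formulas that may depend on the
  type \<^typ>\<open>'a\<close>, because HOL has no quantification over types inside formulas. The witnesses are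
  therefore closed constants of type \<^typ>\<open>fm\<close>, in which no type variable occurs.

  A triple \<open>(u, v, x)\<close> with \<open>u\<close>, \<open>v\<close> non-commuting and \<open>x\<close> commuting with both (hence central)
  represents the \<open>\<alpha>\<close> such that \<open>x\<close> is the \<open>\<alpha>\<close>-multiple of \<open>w = [u, v]\<close>, where the centre is
  identified with the additive group of the field. Relative to the basis \<open>(u, v)\<close>, Maltsev's
  product of central \<open>x\<close> and \<open>y\<close> is \<open>[s, t]\<close> for any \<open>s\<close>, \<open>t\<close> with \<open>[s, u] = [t, v] = 1\<close>,
  \<open>[s, v] = x\<close>, \<open>[u, t] = y\<close>; this is \<^term>\<open>factors u v x y s t\<close>. In particular the product of
  \<open>x\<close> and \<open>w' = [u', v']\<close> relative to \<open>(u, v)\<close> is the \<open>\<alpha>\<close>-multiple of \<open>w'\<close>, that is, the central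
  element that represents \<open>\<alpha>\<close> relative to \<open>(u', v')\<close>. This translates between bases.\<close>

abbreviation comm :: "gterm \<Rightarrow> gterm \<Rightarrow> gterm" where
  "comm s t \<equiv> Mult (Mult (Inv s) (Inv t)) (Mult s t)"

definition factors :: "gterm \<Rightarrow> gterm \<Rightarrow> gterm \<Rightarrow> gterm \<Rightarrow> gterm \<Rightarrow> gterm \<Rightarrow> fm" where
  "factors u v x y s t =
     Conj (Conj (Eq (comm s u) One) (Eq (comm t v) One))
          (Conj (Eq (comm s v) x) (Eq (comm u t) y))"

definition delta_fm :: fm where
  "delta_fm =
     Conj (Neg (Eq (comm (Var 0) (Var 1)) One))
          (Conj (Eq (comm (Var 2) (Var 0)) One) (Eq (comm (Var 2) (Var 1)) One))"

text \<open>The variables 0 to 8 are the three triples \<open>(u, v, x)\<close>, \<open>(u', v', y)\<close>, \<open>(u'', v'', z)\<close>.\<close>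

definition sigma_with :: "fm \<Rightarrow> fm" where
  "sigma_with \<psi> =
     Exs [6, 7]
       (Conj (factors (Var 0) (Var 1) (Var 2) (comm (Var 3) (Var 4)) (Var 6) (Var 7)) \<psi>)"

definition sigma_eq :: fm where
  "sigma_eq = Eq (comm (Var 6) (Var 7)) (Var 5)"

definition sigma_fm :: fm where "sigma_fm = sigma_with sigma_eq"
definition sigma'_fm :: fm where "sigma'_fm = sigma_with (Neg sigma_eq)"

text \<open>Here \<open>[9, 10]\<close> and \<open>[11, 12]\<close> are the second and the third element translated to the
  basis \<open>(u, v)\<close>.\<close>

definition translated :: fm where
  "translated =
     Conj (factors (Var 3) (Var 4) (Var 5) (comm (Var 0) (Var 1)) (Var 9) (Var 10))
          (factors (Var 6) (Var 7) (Var 8) (comm (Var 0) (Var 1)) (Var 11) (Var 12))"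

definition rho_add_with :: "fm \<Rightarrow> fm" where
  "rho_add_with \<psi> = Exs [9, 10, 11, 12] (Conj translated \<psi>)"

definition rho_add_eq :: fm where
  "rho_add_eq = Eq (Mult (Var 2) (comm (Var 9) (Var 10))) (comm (Var 11) (Var 12))"

definition rho_add_fm :: fm where "rho_add_fm = rho_add_with rho_add_eq"
definition rho_add'_fm :: fm where "rho_add'_fm = rho_add_with (Neg rho_add_eq)"

definition rho_mult_with :: "fm \<Rightarrow> fm" where
  "rho_mult_with \<psi> =
     Exs [9, 10, 11, 12, 13, 14]
       (Conj (Conj translated
                (factors (Var 0) (Var 1) (Var 2) (comm (Var 9) (Var 10)) (Var 13) (Var 14))) \<psi>)"

definition rho_mult_eq :: fm where
  "rho_mult_eq = Eq (comm (Var 13) (Var 14)) (comm (Var 11) (Var 12))"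

definition rho_mult_fm :: fm where "rho_mult_fm = rho_mult_with rho_mult_eq"
definition rho_mult'_fm :: fm where "rho_mult'_fm = rho_mult_with (Neg rho_mult_eq)"

end

(* The central element [g, h] is the determinant of the images of g and h
   in F^2. The Pluecker relation
     det(s,t) det(u,v) = det(s,u) det(t,v) + det(s,v) det(u,t)
   therefore turns the conditions [s,u] = [t,v] = 1, [s,v] = x, [u,t] = y into
   det(s,t) = x y / det(u,v), independently of the choice of s and t; such s and t exist, as
   multiples of u and v. So every witness of the formulas computes the same value, and negating the
   final equation defines the complement. All relations are then pullbacks of their counterparts
   on F along the coordinate map (u,v,x) |-> x / det(u,v). *)

theory Submission
  imports Defs "HOL-Analysis.Cartesian_Space"
begin

section \<open>Quotients by the kernel of a map\<close>

text \<open>\<open>E\<close> is the kernel of \<open>f\<close>, and \<open>P\<close> and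
  \<open>T\<close> are preimages under \<open>f\<close>. So both are unions of products of classes,
  and \<open>f\<close> factors through \<open>D // E\<close> as a bijection onto its image
  \<open>B\<close> that carries the quotient relations to \<open>P'\<close> and
  \<open>T'\<close>.\<close>

lemma
  fixes f :: "'b \<Rightarrow> 'a"
  assumes B: "f ` D = B"
    and E: "E = {(x, y). x \<in> D \<and> y \<in> D \<and> f x = f y}"
    and P: "P = {(x, y, z). x \<in> D \<and> y \<in> D \<and> z \<in> D \<and> (f x, f y, f z) \<in> P'}"
    and T: "T = {(x, y, z). x \<in> D \<and> y \<in> D \<and> z \<in> D \<and> (f x, f y, f z) \<in> T'}"
  shows equiv_kernel: "equiv D E"
    and respects3_pullback: "respects3 E P" "respects3 E T"
    and structure_iso_kernel_quotient:
      "\<exists>g. structure_iso (D // E) (quot_rel3 E P) (quot_rel3 E T) B P' T' g"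
proof -
  show eq: "equiv D E"
    unfolding E by (auto intro!: equivI refl_onI symI transI)
  show "respects3 E P" "respects3 E T"
    unfolding respects3_def E P T by auto
  \<comment> \<open>\<open>f\<close> is constant on each class, so the image of a class is a
    singleton; taking its element avoids a choice of representatives.\<close>
  define g where "g X = the_elem (f ` X)" for X
  have g: "g (E `` {x}) = f x" if "x \<in> D" for x
  proof -
    have "f ` (E `` {x}) = {f x}"
      using that by (auto simp: E)
    then show ?thesis by (simp add: g_def)
  qed
  have cls: "E `` {x} = E `` {y} \<longleftrightarrow> f x = f y" if "x \<in> D" "y \<in> D" for x y
    using that by (subst eq_equiv_class_iff[OF eq]) (auto simp: E)
  \<comment> \<open>Membership in \<open>quot_rel3\<close> only yields some representatives; by
    \<open>cls\<close> they have the same \<open>f\<close>-values as \<open>x\<close>,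
    \<open>y\<close>, \<open>z\<close>. The claim is generic in \<open>R\<close> and serves both
    \<open>P\<close> and \<open>T\<close>.\<close>
  have q: "(E `` {x}, E `` {y}, E `` {z}) \<in> quot_rel3 E R \<longleftrightarrow> (f x, f y, f z) \<in> R'"
    if "x \<in> D" "y \<in> D" "z \<in> D"
      and R: "R = {(x, y, z). x \<in> D \<and> y \<in> D \<and> z \<in> D \<and> (f x, f y, f z) \<in> R'}"
    for x y z R R'
  proof
    assume "(E `` {x}, E `` {y}, E `` {z}) \<in> quot_rel3 E R"
    then obtain x' y' z' where "(x', y', z') \<in> R"
      "E `` {x} = E `` {x'}" "E `` {y} = E `` {y'}" "E `` {z} = E `` {z'}"
      unfolding quot_rel3_def by blast
    then show "(f x, f y, f z) \<in> R'"
      using that cls by (auto simp: R)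
  next
    assume "(f x, f y, f z) \<in> R'"
    then show "(E `` {x}, E `` {y}, E `` {z}) \<in> quot_rel3 E R"
      using that unfolding quot_rel3_def R by blast
  qed
  have "bij_betw g (D // E) B"
    unfolding bij_betw_def
  proof
    show "inj_on g (D // E)"
    proof (rule inj_onI, elim quotientE)
      fix X Y x y
      assume "g X = g Y" "x \<in> D" "X = E `` {x}" "y \<in> D" "Y = E `` {y}"
      then show "X = Y" by (simp add: g cls)
    qed
    show "g ` (D // E) = B"
      unfolding B[symmetric] quotient_def by (auto simp: g image_iff)
  qed
  moreover have "((X, Y, Z) \<in> quot_rel3 E P \<longleftrightarrow> (g X, g Y, g Z) \<in> P') \<and>
      ((X, Y, Z) \<in> quot_rel3 E T \<longleftrightarrow> (g X, g Y, g Z) \<in> T')"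
    if XYZ: "X \<in> D // E" "Y \<in> D // E" "Z \<in> D // E" for X Y Z
  proof -
    obtain x y z where xyz: "x \<in> D" "y \<in> D" "z \<in> D"
      and eqs: "X = E `` {x}" "Y = E `` {y}" "Z = E `` {z}"
      using XYZ by (elim quotientE) blast
    show ?thesis
      unfolding eqs g[OF xyz(1)] g[OF xyz(2)] g[OF xyz(3)]
      using q[OF xyz P] q[OF xyz T] by blast
  qed
  ultimately have "structure_iso (D // E) (quot_rel3 E P) (quot_rel3 E T) B P' T' g"
    unfolding structure_iso_def by blast
  then show "\<exists>g. structure_iso (D // E) (quot_rel3 E P) (quot_rel3 E T) B P' T' g"
    by blast
qed

section \<open>The Heisenberg group over a commutative ring\<close>

lemma heis_mat_nth [simp]:
  "heis_mat F a b c $ 1 $ 2 = a" "heis_mat F a b c $ 2 $ 3 = b" "heis_mat F a b c $ 1 $ 3 = c"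
  by (simp_all add: heis_mat_def)

lemma heis_mat_eq_iff: "heis_mat F a b c = heis_mat F a' b' c' \<longleftrightarrow> a = a' \<and> b = b' \<and> c = c'"
  by (metis heis_mat_nth)

lemma (in abelian_monoid) finsum_3:
  fixes f :: "3 \<Rightarrow> 'a"
  assumes "\<And>k. f k \<in> carrier G"
  shows "(\<Oplus>k\<in>UNIV. f k) = f 1 \<oplus> (f 2 \<oplus> f 3)"
proof -
  have "(\<Oplus>k\<in>{1, 2, 3 :: 3}. f k) = f 1 \<oplus> (f 2 \<oplus> f 3)"
    using assms by (subst finsum_insert; simp)+
  then show ?thesis
    by (simp only: UNIV_3)
qed

lemma (in cring) mat_mult3_heis_mat:
  assumes "a \<in> carrier R" "b \<in> carrier R" "c \<in> carrier R"
    "a' \<in> carrier R" "b' \<in> carrier R" "c' \<in> carrier R"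
  shows "mat_mult3 R (heis_mat R a b c) (heis_mat R a' b' c') =
    heis_mat R (a \<oplus> a') (b \<oplus> b') (c \<oplus> c' \<oplus> a \<otimes> b')"
proof -
  have closed: "heis_mat R a b c $ i $ k \<otimes> heis_mat R a' b' c' $ k $ j \<in> carrier R" for i j k
    using assms by (simp add: heis_mat_def)
  show ?thesis
    unfolding vec_eq_iff forall_3 mat_mult3_def
    \<comment> \<open>\<open>heis_mat\<close> stays folded in the first call, so that the sums still
      match \<open>finsum_3[OF closed]\<close>; only the second call evaluates entries.\<close>
    using assms by (simp add: finsum_3[OF closed]) (simp add: heis_mat_def a_ac)
qed

lemma heis_mat_in_carrier [simp]:
  "heis_mat F a b c \<in> carrier (heisenberg F) \<longleftrightarrow>
    a \<in> carrier F \<and> b \<in> carrier F \<and> c \<in> carrier F"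
  by (auto simp: heisenberg_def heis_mat_eq_iff)

lemma heisenbergE:
  assumes "g \<in> carrier (heisenberg F)"
  obtains a b c where "g = heis_mat F a b c"
    "a \<in> carrier F" "b \<in> carrier F" "c \<in> carrier F"
  using assms by (auto simp: heisenberg_def)

lemma one_heisenberg: "\<one>\<^bsub>heisenberg F\<^esub> = heis_mat F \<zero>\<^bsub>F\<^esub> \<zero>\<^bsub>F\<^esub> \<zero>\<^bsub>F\<^esub>"
  by (simp add: heisenberg_def)

lemma (in cring) mult_heisenberg:
  assumes "a \<in> carrier R" "b \<in> carrier R" "c \<in> carrier R"
    "a' \<in> carrier R" "b' \<in> carrier R" "c' \<in> carrier R"
  shows "heis_mat R a b c \<otimes>\<^bsub>heisenberg R\<^esub> heis_mat R a' b' c' =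
    heis_mat R (a \<oplus> a') (b \<oplus> b') (c \<oplus> c' \<oplus> a \<otimes> b')"
  using mat_mult3_heis_mat[OF assms] by (simp add: heisenberg_def)

text \<open>The product formula adds \<open>\<ominus> a \<otimes> b\<close> to the sum of the
  corners, which forces the corner \<open>a \<otimes> b \<ominus> c\<close> of the inverse.\<close>

lemma (in cring) heis_mat_l_inv:
  assumes "a \<in> carrier R" "b \<in> carrier R" "c \<in> carrier R"
  shows "heis_mat R (\<ominus> a) (\<ominus> b) (a \<otimes> b \<ominus> c) \<otimes>\<^bsub>heisenberg R\<^esub> heis_mat R a b c =
    \<one>\<^bsub>heisenberg R\<^esub>"
proof -
  have "a \<otimes> b \<ominus> c \<oplus> c \<oplus> \<ominus> a \<otimes> b = \<zero>"
    using assms by algebra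
  with assms show ?thesis
    by (simp add: mult_heisenberg one_heisenberg l_neg)
qed

text \<open>Associativity rests on the bilinearity of the corner term \<open>a \<otimes> b'\<close>:
  both bracketings add \<open>a \<otimes> b'\<close>, \<open>a \<otimes> b''\<close> and
  \<open>a' \<otimes> b''\<close> to the sum of the corners.\<close>

lemma (in cring) group_heisenberg: "group (heisenberg R)"
proof (rule groupI)
  fix x
  assume "x \<in> carrier (heisenberg R)"
  then obtain a b c where x: "x = heis_mat R a b c"
    and abc: "a \<in> carrier R" "b \<in> carrier R" "c \<in> carrier R"
    by (rule heisenbergE)
  show "\<one>\<^bsub>heisenberg R\<^esub> \<otimes>\<^bsub>heisenberg R\<^esub> x = x"
    using abc by (simp add: x one_heisenberg mult_heisenberg)
  show "\<exists>y\<in>carrier (heisenberg R). y \<otimes>\<^bsub>heisenberg R\<^esub> x = \<one>\<^bsub>heisenberg R\<^esub>"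
    unfolding x
  proof
    show "heis_mat R (\<ominus> a) (\<ominus> b) (a \<otimes> b \<ominus> c) \<otimes>\<^bsub>heisenberg R\<^esub> heis_mat R a b c =
        \<one>\<^bsub>heisenberg R\<^esub>"
      using abc by (rule heis_mat_l_inv)
  qed (simp add: abc)
  fix y
  assume "y \<in> carrier (heisenberg R)"
  then obtain a' b' c' where y: "y = heis_mat R a' b' c'"
    and abc': "a' \<in> carrier R" "b' \<in> carrier R" "c' \<in> carrier R"
    by (rule heisenbergE)
  show "x \<otimes>\<^bsub>heisenberg R\<^esub> y \<in> carrier (heisenberg R)"
    using abc abc' by (simp add: x y mult_heisenberg)
  fix z
  assume "z \<in> carrier (heisenberg R)"
  then obtain a'' b'' c'' where z: "z = heis_mat R a'' b'' c''"
    and abc'': "a'' \<in> carrier R" "b'' \<in> carrier R" "c'' \<in> carrier R"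
    by (rule heisenbergE)
  show "x \<otimes>\<^bsub>heisenberg R\<^esub> y \<otimes>\<^bsub>heisenberg R\<^esub> z = x \<otimes>\<^bsub>heisenberg R\<^esub> (y \<otimes>\<^bsub>heisenberg R\<^esub> z)"
    using abc abc' abc''
    by (simp add: x y z mult_heisenberg heis_mat_eq_iff a_ac l_distr r_distr)
qed (simp add: one_heisenberg)

section \<open>Commutators as determinants\<close>

text \<open>Bracketed exactly like the term \<open>comm\<close>, so that rewriting with
  \<open>comm_val_def[symmetric]\<close> folds the values of such terms.\<close>

definition comm_val :: "('g, 'm) monoid_scheme \<Rightarrow> 'g \<Rightarrow> 'g \<Rightarrow> 'g" where
  "comm_val G g h = (inv\<^bsub>G\<^esub> g \<otimes>\<^bsub>G\<^esub> inv\<^bsub>G\<^esub> h) \<otimes>\<^bsub>G\<^esub> (g \<otimes>\<^bsub>G\<^esub> h)"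

definition heis_det :: "('a, 'm) ring_scheme \<Rightarrow> 'a ^ 3 ^ 3 \<Rightarrow> 'a ^ 3 ^ 3 \<Rightarrow> 'a" where
  "heis_det F g h = g $ 1 $ 2 \<otimes>\<^bsub>F\<^esub> h $ 2 $ 3 \<ominus>\<^bsub>F\<^esub> h $ 1 $ 2 \<otimes>\<^bsub>F\<^esub> g $ 2 $ 3"

lemma (in cring) inv_heisenberg:
  assumes "a \<in> carrier R" "b \<in> carrier R" "c \<in> carrier R"
  shows "inv\<^bsub>heisenberg R\<^esub> (heis_mat R a b c) = heis_mat R (\<ominus> a) (\<ominus> b) (a \<otimes> b \<ominus> c)"
  using assms by (intro group.inv_equality[OF group_heisenberg] heis_mat_l_inv) auto

text \<open>The commutator in a central extension of an abelian group is the antisymmetrization of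
  the cocycle, here of \<open>a \<otimes> b'\<close>.\<close>

lemma (in cring) comm_val_heisenberg:
  assumes "g \<in> carrier (heisenberg R)" "h \<in> carrier (heisenberg R)"
  shows "comm_val (heisenberg R) g h = heis_mat R \<zero> \<zero> (heis_det R g h)"
proof -
  obtain a b c where g: "g = heis_mat R a b c"
    and abc: "a \<in> carrier R" "b \<in> carrier R" "c \<in> carrier R"
    using assms by (auto elim: heisenbergE)
  obtain a' b' c' where h: "h = heis_mat R a' b' c'"
    and abc': "a' \<in> carrier R" "b' \<in> carrier R" "c' \<in> carrier R"
    using assms by (auto elim: heisenbergE)
  \<comment> \<open>\<open>1\<close> clears the two superdiagonal entries; the left side of
    \<open>2\<close> is the corner in the form in which the inverse and product formulas leave
    it.\<close>
  have 1: "\<ominus> x \<oplus> \<ominus> y \<oplus> (x \<oplus> y) = \<zero>" if "x \<in> carrier R" "y \<in> carrier R" for x y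
    using that by algebra
  have 2: "a \<otimes> b \<ominus> c \<oplus> (a' \<otimes> b' \<ominus> c') \<oplus> \<ominus> a \<otimes> \<ominus> b' \<oplus> (c \<oplus> c' \<oplus> a \<otimes> b') \<oplus>
      (\<ominus> a \<oplus> \<ominus> a') \<otimes> (b \<oplus> b') = a \<otimes> b' \<ominus> a' \<otimes> b"
    using abc abc' by algebra
  show ?thesis
    using abc abc' unfolding g h comm_val_def heis_det_def
    by (simp add: inv_heisenberg mult_heisenberg heis_mat_eq_iff 1 2)
qed

lemma heis_det_heis_mat [simp]:
  "heis_det F (heis_mat F a b c) (heis_mat F a' b' c') = a \<otimes>\<^bsub>F\<^esub> b' \<ominus>\<^bsub>F\<^esub> a' \<otimes>\<^bsub>F\<^esub> b"
  by (simp add: heis_det_def)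

lemma (in cring) heis_det_closed [simp]:
  assumes "g \<in> carrier (heisenberg R)" "h \<in> carrier (heisenberg R)"
  shows "heis_det R g h \<in> carrier R"
  using assms by (auto elim!: heisenbergE)

text \<open>A polynomial identity in the eight superdiagonal entries, hence valid over every
  commutative ring. It serves twice: to show centrality and to compute Maltsev's product.\<close>

lemma (in cring) heis_det_pluecker:
  assumes "s \<in> carrier (heisenberg R)" "t \<in> carrier (heisenberg R)"
    "u \<in> carrier (heisenberg R)" "v \<in> carrier (heisenberg R)"
  shows "heis_det R s t \<otimes> heis_det R u v =
    heis_det R s u \<otimes> heis_det R t v \<oplus> heis_det R s v \<otimes> heis_det R u t"
proof -
  obtain a b m where s: "s = heis_mat R a b m" "a \<in> carrier R" "b \<in> carrier R"
    using assms(1) by (rule heisenbergE)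
  obtain a' b' m' where t: "t = heis_mat R a' b' m'" "a' \<in> carrier R" "b' \<in> carrier R"
    using assms(2) by (rule heisenbergE)
  obtain c d n where u: "u = heis_mat R c d n" "c \<in> carrier R" "d \<in> carrier R"
    using assms(3) by (rule heisenbergE)
  obtain c' d' n' where v: "v = heis_mat R c' d' n'" "c' \<in> carrier R" "d' \<in> carrier R"
    using assms(4) by (rule heisenbergE)
  have "(a \<otimes> b' \<ominus> a' \<otimes> b) \<otimes> (c \<otimes> d' \<ominus> c' \<otimes> d) =
      (a \<otimes> d \<ominus> c \<otimes> b) \<otimes> (a' \<otimes> d' \<ominus> c' \<otimes> b') \<oplus> (a \<otimes> d' \<ominus> c' \<otimes> b) \<otimes> (c \<otimes> b' \<ominus> a' \<otimes> d)"
    using s t u v by algebra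
  then show ?thesis
    by (simp only: s t u v heis_det_heis_mat)
qed

text \<open>With \<open>s = x\<close> the right side of the Pluecker relation vanishes for every
  \<open>t\<close>. As \<open>heis_det R u v\<close> is no zero divisor, \<open>x\<close> has
  determinant zero with every element of the group.\<close>

lemma (in domain) central_heisenberg:
  assumes "u \<in> carrier (heisenberg R)" "v \<in> carrier (heisenberg R)"
    and x: "x \<in> carrier (heisenberg R)"
    and det: "heis_det R u v \<noteq> \<zero>"
    and "heis_det R x u = \<zero>" "heis_det R x v = \<zero>"
  obtains c where "c \<in> carrier R" "x = heis_mat R \<zero> \<zero> c"
proof -
  obtain a b c where abc: "a \<in> carrier R" "b \<in> carrier R" "c \<in> carrier R"
    and x_eq: "x = heis_mat R a b c"
    using x by (rule heisenbergE)
  have pl: "heis_det R x t \<otimes> heis_det R u v = \<zero>" if "t \<in> carrier (heisenberg R)" for t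
    using heis_det_pluecker[OF x that assms(1,2)] assms that by simp
  have z: "heis_det R x t = \<zero>" if "t \<in> carrier (heisenberg R)" for t
    using pl[OF that] that assms by (auto dest: integral)
  \<comment> \<open>The two standard basis vectors as \<open>t\<close> give the determinants
    \<open>a\<close> and \<open>\<ominus> b\<close>.\<close>
  have "a = \<zero>"
    using z[of "heis_mat R \<zero> \<one> \<zero>"] abc by (simp add: x_eq a_minus_def)
  moreover have "b = \<zero>"
    using z[of "heis_mat R \<one> \<zero> \<zero>"] abc by (simp add: x_eq a_minus_def)
  ultimately show ?thesis
    using that abc x_eq by blast
qed

section \<open>Maltsev's product: existence and independence of the witnesses\<close>

definition is_factoring :: "('g, 'm) monoid_scheme \<Rightarrow> 'g \<Rightarrow> 'g \<Rightarrow> 'g \<Rightarrow> 'g \<Rightarrow> 'g \<Rightarrow> 'g \<Rightarrow> bool" where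
  "is_factoring G u v x y s t \<longleftrightarrow>
     comm_val G s u = \<one>\<^bsub>G\<^esub> \<and> comm_val G t v = \<one>\<^bsub>G\<^esub> \<and> comm_val G s v = x \<and> comm_val G u t = y"

lemma sat_factors:
  "sat G e (factors u v x y s t) \<longleftrightarrow>
    is_factoring G (term_val G e u) (term_val G e v) (term_val G e x) (term_val G e y)
      (term_val G e s) (term_val G e t)"
  by (auto simp: factors_def is_factoring_def comm_val_def)

lemma (in field) inv_mult_cancel:
  assumes "x \<in> carrier R" "d \<in> carrier R" "d \<noteq> \<zero>"
  shows "inv d \<in> carrier R" "x \<otimes> inv d \<otimes> d = x"
  using assms by (auto simp: field_Units m_assoc)

text \<open>Independence of the witnesses. The value is arranged as the coordinate
  \<open>x \<otimes> inv (heis_det R u v)\<close> times \<open>y\<close>, so one computation covers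
  both uses: change of basis, where \<open>y\<close> is the determinant of the new basis, and
  multiplication in the field.\<close>

lemma (in field) comm_val_factoring:
  assumes uv: "u \<in> carrier (heisenberg R)" "v \<in> carrier (heisenberg R)" "heis_det R u v \<noteq> \<zero>"
    and xy: "x \<in> carrier R" "y \<in> carrier R"
    and st: "s \<in> carrier (heisenberg R)" "t \<in> carrier (heisenberg R)"
    and fac: "is_factoring (heisenberg R) u v (heis_mat R \<zero> \<zero> x) (heis_mat R \<zero> \<zero> y) s t"
  shows "comm_val (heisenberg R) s t = heis_mat R \<zero> \<zero> (x \<otimes> inv (heis_det R u v) \<otimes> y)"
proof -
  let ?d = "heis_det R u v"
  have d: "?d \<in> carrier R" "inv ?d \<in> carrier R" and cancel: "x \<otimes> inv ?d \<otimes> ?d = x"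
    using uv xy inv_mult_cancel[of x ?d] by auto
  have "heis_det R s t \<otimes> ?d = x \<otimes> y"
    using heis_det_pluecker[OF st uv(1,2)] fac uv st xy
    by (simp add: is_factoring_def comm_val_heisenberg one_heisenberg heis_mat_eq_iff)
  \<comment> \<open>Division by \<open>?d\<close>: a factor \<open>?d\<close> is produced on the
    right as well and then cancelled.\<close>
  also have "\<dots> = x \<otimes> inv ?d \<otimes> ?d \<otimes> y"
    by (simp only: cancel)
  also have "\<dots> = (x \<otimes> inv ?d \<otimes> y) \<otimes> ?d"
    using d xy by (simp add: m_ac)
  finally have "heis_det R s t = x \<otimes> inv ?d \<otimes> y"
    using d xy uv st by (subst (asm) m_rcancel) auto
  then show ?thesis
    using st by (simp add: comm_val_heisenberg)
qed

lemma (in field) ex_factoring: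
  assumes uv: "u \<in> carrier (heisenberg R)" "v \<in> carrier (heisenberg R)" "heis_det R u v \<noteq> \<zero>"
    and xy: "x \<in> carrier R" "y \<in> carrier R"
  shows "\<exists>s\<in>carrier (heisenberg R). \<exists>t\<in>carrier (heisenberg R).
    is_factoring (heisenberg R) u v (heis_mat R \<zero> \<zero> x) (heis_mat R \<zero> \<zero> y) s t"
proof -
  obtain a b c where u: "u = heis_mat R a b c"
    and abc: "a \<in> carrier R" "b \<in> carrier R" "c \<in> carrier R"
    using uv(1) by (rule heisenbergE)
  obtain a' b' c' where v: "v = heis_mat R a' b' c'"
    and abc': "a' \<in> carrier R" "b' \<in> carrier R" "c' \<in> carrier R"
    using uv(2) by (rule heisenbergE)
  define d where "d = a \<otimes> b' \<ominus> a' \<otimes> b"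
  have d: "d \<in> carrier R" "d \<noteq> \<zero>"
    using abc abc' uv(3) by (simp_all add: d_def u v)
  \<comment> \<open>Modulo the centre the witnesses are \<open>s = k u\<close> and
    \<open>t = l v\<close>. From det(k u, v) = k d and det(u, l v) = l d come the values of
    \<open>k\<close> and \<open>l\<close>; the corners of \<open>s\<close> and \<open>t\<close> do
    not affect commutators and are set to zero.\<close>
  define k where "k = x \<otimes> inv d"
  define l where "l = y \<otimes> inv d"
  have k: "k \<in> carrier R" "k \<otimes> d = x" and l: "l \<in> carrier R" "l \<otimes> d = y"
    using inv_mult_cancel[OF _ d] xy by (simp_all add: k_def l_def)
  have eqs: "(k \<otimes> a) \<otimes> b \<ominus> a \<otimes> (k \<otimes> b) = \<zero>" "(l \<otimes> a') \<otimes> b' \<ominus> a' \<otimes> (l \<otimes> b') = \<zero>"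
    "(k \<otimes> a) \<otimes> b' \<ominus> a' \<otimes> (k \<otimes> b) = x" "a \<otimes> (l \<otimes> b') \<ominus> (l \<otimes> a') \<otimes> b = y"
    \<comment> \<open>Replacing \<open>x\<close> and \<open>y\<close> by
      \<open>k \<otimes> d\<close> and \<open>l \<otimes> d\<close>, with \<open>d\<close> expanded,
      leaves pure polynomial identities without inverses.\<close>
    using abc abc' k(1) l(1) unfolding k(2)[symmetric] l(2)[symmetric] d_def by algebra+
  show ?thesis
  proof (intro bexI)
    show "is_factoring (heisenberg R) u v (heis_mat R \<zero> \<zero> x) (heis_mat R \<zero> \<zero> y)
        (heis_mat R (k \<otimes> a) (k \<otimes> b) \<zero>) (heis_mat R (l \<otimes> a') (l \<otimes> b') \<zero>)"
      unfolding is_factoring_def u v using abc abc' k(1) l(1)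
      by (simp add: comm_val_heisenberg one_heisenberg eqs)
  qed (use abc abc' k(1) l(1) in simp_all)
qed

text \<open>Witnesses exist and all have the same commutator, so a condition \<open>Q\<close>
  decided by that commutator can be pulled out of the quantifiers. This holds for an equation and
  for its negation alike, which is how the primed formulas come to define complements.\<close>

lemma (in field) ex_factoring_iff:
  assumes uv: "u \<in> carrier (heisenberg R)" "v \<in> carrier (heisenberg R)" "heis_det R u v \<noteq> \<zero>"
    and xy: "x \<in> carrier R" "y \<in> carrier R"
    and Q: "\<And>s t. s \<in> carrier (heisenberg R) \<Longrightarrow> t \<in> carrier (heisenberg R) \<Longrightarrow>
      comm_val (heisenberg R) s t = heis_mat R \<zero> \<zero> (x \<otimes> inv (heis_det R u v) \<otimes> y) \<Longrightarrow>
      Q s t \<longleftrightarrow> q"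
  shows "(\<exists>s\<in>carrier (heisenberg R). \<exists>t\<in>carrier (heisenberg R).
    is_factoring (heisenberg R) u v (heis_mat R \<zero> \<zero> x) (heis_mat R \<zero> \<zero> y) s t \<and> Q s t) \<longleftrightarrow> q"
  using ex_factoring[OF uv xy] comm_val_factoring[OF uv xy] Q by blast

section \<open>Representing triples and their coordinates\<close>

definition heis_reps :: "('a, 'm) ring_scheme \<Rightarrow> ('a ^ 3 ^ 3) list set" where
  "heis_reps F = {[u, v, heis_mat F \<zero>\<^bsub>F\<^esub> \<zero>\<^bsub>F\<^esub> c] | u v c.
     u \<in> carrier (heisenberg F) \<and> v \<in> carrier (heisenberg F) \<and> c \<in> carrier F \<and>
     heis_det F u v \<noteq> \<zero>\<^bsub>F\<^esub>}"

definition heis_coord :: "('a, 'm) ring_scheme \<Rightarrow> ('a ^ 3 ^ 3) list \<Rightarrow> 'a" where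
  "heis_coord F p = (p ! 2) $ 1 $ 3 \<otimes>\<^bsub>F\<^esub> inv\<^bsub>F\<^esub> (heis_det F (p ! 0) (p ! 1))"

text \<open>Besides the shape of \<open>p\<close>, this supplies its determinant under an opaque
  name \<open>d\<close> and the equation \<open>c \<otimes> inv d \<otimes> d = c\<close>, by which
  denominators are cleared later.\<close>

lemma (in field) heis_repsE:
  assumes "p \<in> heis_reps R"
  obtains u v c d where
    "p = [u, v, heis_mat R \<zero> \<zero> c]"
    "u \<in> carrier (heisenberg R)" "v \<in> carrier (heisenberg R)" "c \<in> carrier R"
    "heis_det R u v = d" "d \<in> carrier R" "d \<noteq> \<zero>"
    "heis_coord R p = c \<otimes> inv d" "c \<otimes> inv d \<in> carrier R" "c \<otimes> inv d \<otimes> d = c"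
proof -
  obtain u v c where p: "p = [u, v, heis_mat R \<zero> \<zero> c]"
    and uvc: "u \<in> carrier (heisenberg R)" "v \<in> carrier (heisenberg R)" "c \<in> carrier R"
      "heis_det R u v \<noteq> \<zero>"
    using assms unfolding heis_reps_def by blast
  show ?thesis
    using that[OF p uvc(1-3) refl] uvc inv_mult_cancel[of c "heis_det R u v"]
    by (simp add: heis_coord_def p)
qed

lemma (in field) heis_coord_closed: "p \<in> heis_reps R \<Longrightarrow> heis_coord R p \<in> carrier R"
  by (erule heis_repsE) simp

lemma (in field) heis_coord_surj: "heis_coord R ` heis_reps R = carrier R"
proof (intro equalityI subsetI)
  fix c assume c: "c \<in> carrier R"
  \<comment> \<open>The standard basis has determinant one, so the coordinate is the corner
    itself.\<close>
  let ?p = "[heis_mat R \<one> \<zero> \<zero>, heis_mat R \<zero> \<one> \<zero>, heis_mat R \<zero> \<zero> c]"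
  have "?p \<in> heis_reps R"
    unfolding heis_reps_def using c by (fastforce simp: a_minus_def)
  moreover have "heis_coord R ?p = c"
    using c by (simp add: heis_coord_def a_minus_def)
  ultimately show "c \<in> heis_coord R ` heis_reps R"
    by (metis image_eqI)
qed (auto simp: heis_coord_closed)

section \<open>The formulas evaluated in coordinates\<close>

lemma (in field) defset_delta: "defset (heisenberg R) 3 delta_fm = heis_reps R"
proof (intro equalityI subsetI)
  fix p assume p: "p \<in> defset (heisenberg R) 3 delta_fm"
  then obtain u v x where p_eq: "p = [u, v, x]"
    by (auto simp: defset_def numeral_3_eq_3 length_Suc_conv)
  have uvx: "u \<in> carrier (heisenberg R)" "v \<in> carrier (heisenberg R)" "x \<in> carrier (heisenberg R)"
    using p by (simp_all add: p_eq defset_def)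
  moreover have "comm_val (heisenberg R) u v \<noteq> \<one>\<^bsub>heisenberg R\<^esub>"
    "comm_val (heisenberg R) x u = \<one>\<^bsub>heisenberg R\<^esub>" "comm_val (heisenberg R) x v = \<one>\<^bsub>heisenberg R\<^esub>"
    using p by (simp_all add: p_eq defset_def holds_def delta_fm_def comm_val_def)
  ultimately have det: "heis_det R u v \<noteq> \<zero>" "heis_det R x u = \<zero>" "heis_det R x v = \<zero>"
    by (simp_all add: comm_val_heisenberg one_heisenberg heis_mat_eq_iff)
  obtain c where "c \<in> carrier R" "x = heis_mat R \<zero> \<zero> c"
    using uvx det by (rule central_heisenberg)
  then show "p \<in> heis_reps R"
    using uvx det unfolding p_eq heis_reps_def by blast
next
  fix p assume "p \<in> heis_reps R"
  then obtain u v c where p_eq: "p = [u, v, heis_mat R \<zero> \<zero> c]"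
    and uvc: "u \<in> carrier (heisenberg R)" "v \<in> carrier (heisenberg R)" "c \<in> carrier R"
      "heis_det R u v \<noteq> \<zero>"
    unfolding heis_reps_def by blast
  have "comm_val (heisenberg R) u v \<noteq> \<one>\<^bsub>heisenberg R\<^esub>"
    using uvc by (simp add: comm_val_heisenberg one_heisenberg heis_mat_eq_iff)
  \<comment> \<open>The superdiagonal of the first matrix is zero, so its determinant with any
    \<open>g\<close> vanishes.\<close>
  moreover have "comm_val (heisenberg R) (heis_mat R \<zero> \<zero> c) g = \<one>\<^bsub>heisenberg R\<^esub>"
    if "g \<in> carrier (heisenberg R)" for g
    using that uvc
    by (elim heisenbergE) (simp add: comm_val_heisenberg one_heisenberg heis_mat_eq_iff a_minus_def)
  ultimately show "p \<in> defset (heisenberg R) 3 delta_fm"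
    using uvc by (simp add: p_eq defset_def holds_def delta_fm_def comm_val_def)
qed

text \<open>The witnesses compute the central element with corner
  \<open>c \<otimes> inv d \<otimes> d'\<close>, which represents the coordinate of \<open>p\<close>
  relative to the basis of \<open>q\<close>. It is compared with \<open>c'\<close>, and cancelling
  \<open>d'\<close> turns this into equality of coordinates.\<close>

lemma (in field) holds_sigma:
  assumes "p \<in> heis_reps R" "q \<in> heis_reps R"
  shows "holds (heisenberg R) sigma_fm (p @ q) \<longleftrightarrow> heis_coord R p = heis_coord R q"
    and "holds (heisenberg R) sigma'_fm (p @ q) \<longleftrightarrow> heis_coord R p \<noteq> heis_coord R q"
proof -
  obtain u v c d where p: "p = [u, v, heis_mat R \<zero> \<zero> c]"
    and uv: "u \<in> carrier (heisenberg R)" "v \<in> carrier (heisenberg R)" "c \<in> carrier R"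
      "heis_det R u v = d" "d \<in> carrier R" "d \<noteq> \<zero>"
      "heis_coord R p = c \<otimes> inv d" "c \<otimes> inv d \<in> carrier R" "c \<otimes> inv d \<otimes> d = c"
    using assms(1) by (rule heis_repsE)
  obtain u' v' c' d' where q: "q = [u', v', heis_mat R \<zero> \<zero> c']"
    and uv': "u' \<in> carrier (heisenberg R)" "v' \<in> carrier (heisenberg R)" "c' \<in> carrier R"
      "heis_det R u' v' = d'" "d' \<in> carrier R" "d' \<noteq> \<zero>"
      "heis_coord R q = c' \<otimes> inv d'" "c' \<otimes> inv d' \<in> carrier R" "c' \<otimes> inv d' \<otimes> d' = c'"
    using assms(2) by (rule heis_repsE)
  have eq: "c \<otimes> inv d \<otimes> d' = c' \<longleftrightarrow> heis_coord R p = heis_coord R q"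
    using m_rcancel[of d' "c \<otimes> inv d" "c' \<otimes> inv d'"] uv uv' by simp
  \<comment> \<open>\<open>N\<close> is the identity for \<open>sigma_fm\<close> and
    \<open>Not\<close> for \<open>sigma'_fm\<close>.\<close>
  have main: "(\<exists>s\<in>carrier (heisenberg R). \<exists>t\<in>carrier (heisenberg R).
      is_factoring (heisenberg R) u v (heis_mat R \<zero> \<zero> c) (comm_val (heisenberg R) u' v') s t \<and>
      N (comm_val (heisenberg R) s t = heis_mat R \<zero> \<zero> c')) \<longleftrightarrow>
      N (heis_coord R p = heis_coord R q)" for N :: "bool \<Rightarrow> bool"
    unfolding comm_val_heisenberg[OF uv'(1,2)] uv'(4)
    by (rule ex_factoring_iff) (use uv uv' eq in \<open>simp_all add: heis_mat_eq_iff\<close>)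
  show "holds (heisenberg R) sigma_fm (p @ q) \<longleftrightarrow> heis_coord R p = heis_coord R q"
    using main[of "\<lambda>b. b"]
    by (simp add: p q holds_def sigma_fm_def sigma_with_def sigma_eq_def Exs_def sat_factors
        comm_val_def[symmetric])
  show "holds (heisenberg R) sigma'_fm (p @ q) \<longleftrightarrow> heis_coord R p \<noteq> heis_coord R q"
    using main[of Not]
    by (simp add: p q holds_def sigma'_fm_def sigma_with_def sigma_eq_def Exs_def sat_factors
        comm_val_def[symmetric])
qed

text \<open>Once \<open>q\<close> and \<open>r\<close> are translated to the basis of
  \<open>p\<close>, all three corners are coordinates times the same \<open>d\<close>. Addition is
  then the group product in the centre, multiplication is one more Maltsev product, and
  \<open>d\<close> cancels.\<close>

lemma (in field) holds_rho:
  assumes "p \<in> heis_reps R" "q \<in> heis_reps R" "r \<in> heis_reps R"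
  shows "holds (heisenberg R) rho_add_fm (p @ q @ r) \<longleftrightarrow>
      heis_coord R p \<oplus> heis_coord R q = heis_coord R r"
    and "holds (heisenberg R) rho_add'_fm (p @ q @ r) \<longleftrightarrow>
      heis_coord R p \<oplus> heis_coord R q \<noteq> heis_coord R r"
    and "holds (heisenberg R) rho_mult_fm (p @ q @ r) \<longleftrightarrow>
      heis_coord R p \<otimes> heis_coord R q = heis_coord R r"
    and "holds (heisenberg R) rho_mult'_fm (p @ q @ r) \<longleftrightarrow>
      heis_coord R p \<otimes> heis_coord R q \<noteq> heis_coord R r"
proof -
  let ?H = "heisenberg R" and ?z = "heis_mat R \<zero> \<zero>"
  obtain u v c d where p: "p = [u, v, ?z c]"
    and uv: "u \<in> carrier ?H" "v \<in> carrier ?H" "c \<in> carrier R"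
      "heis_det R u v = d" "d \<in> carrier R" "d \<noteq> \<zero>"
      "heis_coord R p = c \<otimes> inv d" "c \<otimes> inv d \<in> carrier R" "c \<otimes> inv d \<otimes> d = c"
    using assms(1) by (rule heis_repsE)
  obtain u' v' c' d' where q: "q = [u', v', ?z c']"
    and uv': "u' \<in> carrier ?H" "v' \<in> carrier ?H" "c' \<in> carrier R"
      "heis_det R u' v' = d'" "d' \<in> carrier R" "d' \<noteq> \<zero>"
      "heis_coord R q = c' \<otimes> inv d'" "c' \<otimes> inv d' \<in> carrier R" "c' \<otimes> inv d' \<otimes> d' = c'"
    using assms(2) by (rule heis_repsE)
  obtain u'' v'' c'' d'' where r: "r = [u'', v'', ?z c'']"
    and uv'': "u'' \<in> carrier ?H" "v'' \<in> carrier ?H" "c'' \<in> carrier R"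
      "heis_det R u'' v'' = d''" "d'' \<in> carrier R" "d'' \<noteq> \<zero>"
      "heis_coord R r = c'' \<otimes> inv d''" "c'' \<otimes> inv d'' \<in> carrier R" "c'' \<otimes> inv d'' \<otimes> d'' = c''"
    using assms(3) by (rule heis_repsE)
  \<comment> \<open>The corners of the central elements that represent the coordinates of
    \<open>q\<close> and \<open>r\<close> relative to \<open>(u, v)\<close>.\<close>
  define k' where "k' = c' \<otimes> inv d' \<otimes> d"
  define k'' where "k'' = c'' \<otimes> inv d'' \<otimes> d"
  have k: "k' \<in> carrier R" "k'' \<in> carrier R"
    using uv uv' uv'' by (simp_all add: k'_def k''_def)
  have "c \<oplus> k' = (c \<otimes> inv d \<oplus> c' \<otimes> inv d') \<otimes> d"
    using uv(5,8,9) uv'(8) by (simp add: k'_def l_distr)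
  then have add: "c \<oplus> k' = k'' \<longleftrightarrow> heis_coord R p \<oplus> heis_coord R q = heis_coord R r"
    using m_rcancel[of d "c \<otimes> inv d \<oplus> c' \<otimes> inv d'" "c'' \<otimes> inv d''"] uv uv' uv''
    by (simp add: k''_def)
  have "c \<otimes> inv d \<otimes> k' = (c \<otimes> inv d) \<otimes> (c' \<otimes> inv d') \<otimes> d"
    using uv(5,8) uv'(8) unfolding k'_def by (simp only: m_assoc m_closed)
  then have mult: "c \<otimes> inv d \<otimes> k' = k'' \<longleftrightarrow> heis_coord R p \<otimes> heis_coord R q = heis_coord R r"
    using m_rcancel[of d "(c \<otimes> inv d) \<otimes> (c' \<otimes> inv d')" "c'' \<otimes> inv d''"] uv uv' uv''
    by (simp add: k''_def)
  \<comment> \<open>\<open>ex_factoring_iff\<close> applied to two nested witness pairs, for any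
    \<open>Q\<close> that is decided once their commutators are known to be \<open>?z k'\<close> and
    \<open>?z k''\<close>.\<close>
  have translate: "(\<exists>s\<in>carrier ?H. \<exists>t\<in>carrier ?H.
      is_factoring ?H u' v' (?z c') (comm_val ?H u v) s t \<and>
      (\<exists>s'\<in>carrier ?H. \<exists>t'\<in>carrier ?H.
        is_factoring ?H u'' v'' (?z c'') (comm_val ?H u v) s' t' \<and> Q s t s' t')) \<longleftrightarrow> P"
    if "\<And>s t s' t'. comm_val ?H s t = ?z k' \<Longrightarrow> comm_val ?H s' t' = ?z k'' \<Longrightarrow> Q s t s' t' \<longleftrightarrow> P"
    for Q P
    unfolding comm_val_heisenberg[OF uv(1,2)] uv(4)
    by (intro ex_factoring_iff that)
      (use uv uv' uv'' in \<open>simp_all add: k'_def k''_def\<close>)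
  have main_add: "(\<exists>s\<in>carrier ?H. \<exists>t\<in>carrier ?H. \<exists>s'\<in>carrier ?H. \<exists>t'\<in>carrier ?H.
      (is_factoring ?H u' v' (?z c') (comm_val ?H u v) s t \<and>
       is_factoring ?H u'' v'' (?z c'') (comm_val ?H u v) s' t') \<and>
      N (?z c \<otimes>\<^bsub>?H\<^esub> comm_val ?H s t = comm_val ?H s' t')) \<longleftrightarrow>
      N (heis_coord R p \<oplus> heis_coord R q = heis_coord R r)" (is "?L = ?R") for N :: "bool \<Rightarrow> bool"
  proof -
    \<comment> \<open>The formula has all its quantifiers in front; the second pair is moved past
      the condition on the first to match \<open>translate\<close>.\<close>
    have "?L \<longleftrightarrow> (\<exists>s\<in>carrier ?H. \<exists>t\<in>carrier ?H.
      is_factoring ?H u' v' (?z c') (comm_val ?H u v) s t \<and>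
      (\<exists>s'\<in>carrier ?H. \<exists>t'\<in>carrier ?H.
        is_factoring ?H u'' v'' (?z c'') (comm_val ?H u v) s' t' \<and>
        N (?z c \<otimes>\<^bsub>?H\<^esub> comm_val ?H s t = comm_val ?H s' t')))"
      by blast
    also have "\<dots> \<longleftrightarrow> ?R"
      using uv(3) k by (intro translate) (simp add: mult_heisenberg heis_mat_eq_iff add)
    finally show ?thesis .
  qed
  have main_mult: "(\<exists>s\<in>carrier ?H. \<exists>t\<in>carrier ?H. \<exists>s'\<in>carrier ?H. \<exists>t'\<in>carrier ?H.
      \<exists>s''\<in>carrier ?H. \<exists>t''\<in>carrier ?H.
      ((is_factoring ?H u' v' (?z c') (comm_val ?H u v) s t \<and>
       is_factoring ?H u'' v'' (?z c'') (comm_val ?H u v) s' t') \<and>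
       is_factoring ?H u v (?z c) (comm_val ?H s t) s'' t'') \<and>
      N (comm_val ?H s'' t'' = comm_val ?H s' t')) \<longleftrightarrow>
      N (heis_coord R p \<otimes> heis_coord R q = heis_coord R r)" (is "?L = ?R") for N :: "bool \<Rightarrow> bool"
  proof -
    have "?L \<longleftrightarrow> (\<exists>s\<in>carrier ?H. \<exists>t\<in>carrier ?H.
      is_factoring ?H u' v' (?z c') (comm_val ?H u v) s t \<and>
      (\<exists>s'\<in>carrier ?H. \<exists>t'\<in>carrier ?H.
        is_factoring ?H u'' v'' (?z c'') (comm_val ?H u v) s' t' \<and>
        (\<exists>s''\<in>carrier ?H. \<exists>t''\<in>carrier ?H.
          is_factoring ?H u v (?z c) (comm_val ?H s t) s'' t'' \<and>
          N (comm_val ?H s'' t'' = comm_val ?H s' t'))))"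
      by blast
    also have "\<dots> \<longleftrightarrow> ?R"
    \<comment> \<open>The third pair factors relative to \<open>(u, v)\<close> and depends on the
      first through \<open>comm_val ?H s t\<close>. Once this is known to be \<open>?z k'\<close>,
      \<open>ex_factoring_iff\<close> applies again, with value
      \<open>c \<otimes> inv d \<otimes> k'\<close>.\<close>
    proof (rule translate)
      fix s t s' t'
      assume st: "comm_val ?H s t = ?z k'" "comm_val ?H s' t' = ?z k''"
      show "(\<exists>s''\<in>carrier ?H. \<exists>t''\<in>carrier ?H.
          is_factoring ?H u v (?z c) (comm_val ?H s t) s'' t'' \<and>
          N (comm_val ?H s'' t'' = comm_val ?H s' t')) \<longleftrightarrow> ?R"
        unfolding st
        by (rule ex_factoring_iff) (use uv k mult in \<open>simp_all add: heis_mat_eq_iff\<close>)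
    qed
    finally show ?thesis .
  qed
  note defs = holds_def rho_add_fm_def rho_add'_fm_def rho_add_with_def rho_add_eq_def
    rho_mult_fm_def rho_mult'_fm_def rho_mult_with_def rho_mult_eq_def translated_def
    Exs_def sat_factors comm_val_def[symmetric]
  show "holds ?H rho_add_fm (p @ q @ r) \<longleftrightarrow> heis_coord R p \<oplus> heis_coord R q = heis_coord R r"
    \<comment> \<open>Read from right to left, \<open>main_add\<close> turns the coordinate equation
      into the existential statement to which the formula itself unfolds.\<close>
    unfolding main_add[of "\<lambda>b. b", symmetric] by (simp add: p q r defs)
  show "holds ?H rho_add'_fm (p @ q @ r) \<longleftrightarrow> heis_coord R p \<oplus> heis_coord R q \<noteq> heis_coord R r"
    unfolding main_add[of Not, symmetric] by (simp add: p q r defs)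
  show "holds ?H rho_mult_fm (p @ q @ r) \<longleftrightarrow> heis_coord R p \<otimes> heis_coord R q = heis_coord R r"
    unfolding main_mult[of "\<lambda>b. b", symmetric] by (simp add: p q r defs)
  show "holds ?H rho_mult'_fm (p @ q @ r) \<longleftrightarrow> heis_coord R p \<otimes> heis_coord R q \<noteq> heis_coord R r"
    unfolding main_mult[of Not, symmetric] by (simp add: p q r defs)
qed

section \<open>Assembling the interpretation\<close>

lemma (in field) interprets_heisenberg:
  "interprets 3 (heisenberg R) R
     delta_fm sigma_fm sigma'_fm rho_add_fm rho_add'_fm rho_mult_fm rho_mult'_fm"
proof -
  let ?H = "heisenberg R" and ?D = "heis_reps R" and ?f = "heis_coord R"
  have E: "defrel2 ?H ?D sigma_fm = {(x, y). x \<in> ?D \<and> y \<in> ?D \<and> ?f x = ?f y}"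
    by (auto simp: defrel2_def holds_sigma)
  \<comment> \<open>Membership in \<open>graph_add\<close> also requires the summands to lie in the
    carrier, which \<open>heis_coord_closed\<close> provides.\<close>
  have P: "defrel3 ?H ?D rho_add_fm =
      {(x, y, z). x \<in> ?D \<and> y \<in> ?D \<and> z \<in> ?D \<and> (?f x, ?f y, ?f z) \<in> graph_add R}"
    by (auto simp: defrel3_def holds_rho graph_add_def heis_coord_closed)
  have T: "defrel3 ?H ?D rho_mult_fm =
      {(x, y, z). x \<in> ?D \<and> y \<in> ?D \<and> z \<in> ?D \<and> (?f x, ?f y, ?f z) \<in> graph_mult R}"
    by (auto simp: defrel3_def holds_rho graph_mult_def heis_coord_closed)
  have "defrel2 ?H ?D sigma'_fm = ?D \<times> ?D - defrel2 ?H ?D sigma_fm"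
    by (auto simp: defrel2_def holds_sigma)
  moreover have "defrel3 ?H ?D rho_add'_fm = ?D \<times> ?D \<times> ?D - defrel3 ?H ?D rho_add_fm"
    by (auto simp: defrel3_def holds_rho)
  moreover have "defrel3 ?H ?D rho_mult'_fm = ?D \<times> ?D \<times> ?D - defrel3 ?H ?D rho_mult_fm"
    by (auto simp: defrel3_def holds_rho)
  ultimately show ?thesis
    unfolding interprets_def Let_def defset_delta
    using equiv_kernel[OF heis_coord_surj E P T] respects3_pullback[OF heis_coord_surj E P T]
      structure_iso_kernel_quotient[OF heis_coord_surj E P T]
    by blast
qed

section \<open>Syntactic shape of the formulas\<close>

lemma existential_Exs: "quantifier_free \<theta> \<Longrightarrow> existential (Exs ws \<theta>)"
  unfolding existential_def by blast

lemma fv_factors: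
  "fv (factors u v x y s t) =
    fv_term u \<union> fv_term v \<union> fv_term x \<union> fv_term y \<union> fv_term s \<union> fv_term t"
  by (auto simp: factors_def)

lemma quantifier_free_factors: "quantifier_free (factors u v x y s t)"
  by (simp add: factors_def)

theorem theorem4p1:
  fixes F :: "('a, 'm) ring_scheme"
  shows "existential delta_fm \<and> fv delta_fm \<subseteq> {..<3} \<and>
    existential sigma_fm \<and> fv sigma_fm \<subseteq> {..<6} \<and>
    existential sigma'_fm \<and> fv sigma'_fm \<subseteq> {..<6} \<and>
    existential rho_add_fm \<and> fv rho_add_fm \<subseteq> {..<9} \<and>
    existential rho_add'_fm \<and> fv rho_add'_fm \<subseteq> {..<9} \<and>
    existential rho_mult_fm \<and> fv rho_mult_fm \<subseteq> {..<9} \<and>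
    existential rho_mult'_fm \<and> fv rho_mult'_fm \<subseteq> {..<9} \<and>
    (field F \<longrightarrow>
       interprets 3 (heisenberg F) F
         delta_fm sigma_fm sigma'_fm rho_add_fm rho_add'_fm rho_mult_fm rho_mult'_fm)"
proof -
  note defs = delta_fm_def sigma_fm_def sigma'_fm_def sigma_with_def sigma_eq_def
    rho_add_fm_def rho_add'_fm_def rho_add_with_def rho_add_eq_def
    rho_mult_fm_def rho_mult'_fm_def rho_mult_with_def rho_mult_eq_def translated_def
  \<comment> \<open>\<open>delta_fm\<close> is quantifier-free, so its prefix is the empty
    list.\<close>
  have "existential delta_fm"
    using existential_Exs[of delta_fm "[]"] by (simp add: delta_fm_def Exs_def)
  moreover have "existential sigma_fm" "existential sigma'_fm"
    "existential rho_add_fm" "existential rho_add'_fm"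
    "existential rho_mult_fm" "existential rho_mult'_fm"
    unfolding defs by (rule existential_Exs; simp add: quantifier_free_factors)+
  moreover have "fv delta_fm \<subseteq> {..<3}" "fv sigma_fm \<subseteq> {..<6}" "fv sigma'_fm \<subseteq> {..<6}"
    "fv rho_add_fm \<subseteq> {..<9}" "fv rho_add'_fm \<subseteq> {..<9}"
    "fv rho_mult_fm \<subseteq> {..<9}" "fv rho_mult'_fm \<subseteq> {..<9}"
    unfolding defs Exs_def by (auto simp: fv_factors)
  ultimately show ?thesis
    using field.interprets_heisenberg by blast
qed

end
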